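(* Let $R>0$ and let $D$ be a disk of radius $R$ in the hyperbolic plane $\mathbb{H}^2$ (of constant Gaussian curvature $-1$). Then there exists a smooth isometric immersion $\mathbf{x}:D\rightarrow U\subset\mathbb{R}^3$ such that $U=\mathbf{x}(D)$ is a subset of the (upper half of the) pseudosphere.
   Context: A disk of radius $R$ in $\mathbb{H}^2$ is a geodesic disk $D=\{q\in\mathbb{H}^2: d(p,q)<R\}$ for some $p\in\mathbb{H}^2$, where $d$ is the hyperbolic distance; an isometric immersion is a map $\mathbf{x}$ whose pulled-back Euclidean metric equals the hyperbolic metric. It need not be injective. The pseudosphere is the surface in $\mathbb{R}^3$ parameterized by $$\mathbf{y}(\eta,\xi)=\left(\frac{\cos\xi}{\cosh\eta},\ \frac{\sin\xi}{\cosh\eta},\ \eta-\tanh\eta\right),\qquad \xi\in\mathbb{R}.$$ It is singular along the curve $\eta=0$; its upper half is the image of $\{(\eta,\xi):\eta>0,\ \xi\in\mathbb{R}\}$. *)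

theory Defs
  imports "HOL-Analysis.Analysis"
begin

section \<open>The hyperbolic plane (upper half-plane model)\<close>

definition hyp_plane :: "complex set" where
  "hyp_plane = {z. 0 < Im z}"

text \<open>The Riemannian metric \<open>(dx\<^sup>2 + dy\<^sup>2) / y\<^sup>2\<close> of constant Gaussian curvature \<open>-1\<close>:
  the inner product of two tangent vectors \<open>v\<close>, \<open>w\<close> at \<open>z\<close>.  Here \<open>v \<bullet> w\<close> is the real inner
  product of \<open>complex\<close> as a real plane.\<close>

definition hyp_metric :: "complex \<Rightarrow> complex \<Rightarrow> complex \<Rightarrow> real" where
  "hyp_metric z v w = (v \<bullet> w) / (Im z)\<^sup>2"

text \<open>The curves are required to be \<open>C\<^sup>1\<close> up to the end points, not merely to satisfy
  \<^const>\<open>valid_path\<close>: the latter allows the derivative to be unbounded near finitely many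
  parameters, and for a curve of infinite length \<^const>\<open>integral\<close> would return 0.  The velocity may
  vanish, so piecewise \<open>C\<^sup>1\<close> curves can be reparametrized to be \<open>C\<^sup>1\<close>, and the infimum below is the
  usual Riemannian distance.\<close>

definition hyp_curve :: "(real \<Rightarrow> complex) \<Rightarrow> complex \<Rightarrow> complex \<Rightarrow> bool" where
  "hyp_curve \<gamma> p q \<longleftrightarrow>
     \<gamma> C1_differentiable_on {0..1} \<and> path_image \<gamma> \<subseteq> hyp_plane \<and>
     pathstart \<gamma> = p \<and> pathfinish \<gamma> = q"

definition hyp_length :: "(real \<Rightarrow> complex) \<Rightarrow> real" where
  "hyp_length \<gamma> = integral {0..1}
     (\<lambda>t. sqrt (hyp_metric (\<gamma> t) (vector_derivative \<gamma> (at t)) (vector_derivative \<gamma> (at t))))"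

definition hyp_dist :: "complex \<Rightarrow> complex \<Rightarrow> real" where
  "hyp_dist p q = Inf {hyp_length \<gamma> |\<gamma>. hyp_curve \<gamma> p q}"

definition hyp_disk :: "complex \<Rightarrow> real \<Rightarrow> complex set" where
  "hyp_disk p R = {q \<in> hyp_plane. hyp_dist p q < R}"


section \<open>Smooth isometric immersions\<close>

text \<open>All derivatives are two-sided, so these notions are meant for open sets \<open>S\<close>.\<close>

primrec Ck_on :: "nat \<Rightarrow> ('a::real_normed_vector \<Rightarrow> 'b::real_normed_vector) \<Rightarrow> 'a set \<Rightarrow> bool" where
  "Ck_on 0 f S \<longleftrightarrow> continuous_on S f"
| "Ck_on (Suc k) f S \<longleftrightarrow>
     (\<forall>x\<in>S. f differentiable (at x)) \<and> (\<forall>v. Ck_on k (\<lambda>x. frechet_derivative f (at x) v) S)"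

definition smooth_on :: "('a::real_normed_vector \<Rightarrow> 'b::real_normed_vector) \<Rightarrow> 'a set \<Rightarrow> bool" where
  "smooth_on f S \<longleftrightarrow> (\<forall>k. Ck_on k f S)"

text \<open>The pullback of the Euclidean metric is the hyperbolic metric.  As the latter is positive
  definite, the differential is then automatically injective.\<close>

definition isometric_immersion_on :: "(complex \<Rightarrow> real^3) \<Rightarrow> complex set \<Rightarrow> bool" where
  "isometric_immersion_on f S \<longleftrightarrow>
     (\<forall>z\<in>S. f differentiable (at z) \<and>
        (\<forall>v w. frechet_derivative f (at z) v \<bullet> frechet_derivative f (at z) w = hyp_metric z v w))"


section \<open>The pseudosphere\<close>

definition pseudosphere_param :: "real \<Rightarrow> real \<Rightarrow> real^3" where
  "pseudosphere_param \<eta> \<xi> = vector [cos \<xi> / cosh \<eta>, sin \<xi> / cosh \<eta>, \<eta> - tanh \<eta>]"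

definition upper_pseudosphere :: "(real^3) set" where
  "upper_pseudosphere = {pseudosphere_param \<eta> \<xi> |\<eta> \<xi>. \<eta> > 0}"

end

theory Submission
  imports Defs
begin

text \<open>In the upper half-plane the substitution \<open>Im z = cosh \<eta>\<close>, \<open>Re z = \<xi>\<close> turns the hyperbolic
  metric into the pseudosphere metric \<open>d\<xi>\<^sup>2 / cosh\<^sup>2 \<eta> + tanh\<^sup>2 \<eta> d\<eta>\<^sup>2\<close>, so the horodisk \<open>Im z > 1\<close> is
  immersed onto the upper half of the pseudosphere.  As \<open>dy / y\<close> is at most the hyperbolic line
  element, a disk of radius \<open>R\<close> about \<open>p\<close> lies above the height \<open>Im p \<cdot> e\<^sup>-\<^sup>R\<close>, and the
  homothety \<open>z \<mapsto> (e\<^sup>R / Im p) z\<close>, a hyperbolic isometry, moves it into the horodisk.\<close>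

section \<open>Smooth maps\<close>

lemma Ck_on_subset: "Ck_on k f S \<Longrightarrow> T \<subseteq> S \<Longrightarrow> Ck_on k f T"
  by (induction k arbitrary: f) (auto intro: continuous_on_subset)

lemma smooth_on_subset: "smooth_on f S \<Longrightarrow> T \<subseteq> S \<Longrightarrow> smooth_on f T"
  unfolding smooth_on_def by (blast intro: Ck_on_subset)

text \<open>Two-sided derivatives see values near a point, so agreement on \<open>S\<close> passes
  to the derivatives because \<open>S\<close> is open.\<close>

lemma Ck_on_cong:
  assumes "open S" and "\<And>x. x \<in> S \<Longrightarrow> f x = g x" and "Ck_on k f S"
  shows "Ck_on k g S"
  using assms(2,3)
proof (induction k arbitrary: f g)
  case 0
  then show ?case by (simp cong: continuous_on_cong)
next
  case (Suc k)
  have der: "(g has_derivative frechet_derivative f (at x)) (at x)" if "x \<in> S" for x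
  proof -
    have "(f has_derivative frechet_derivative f (at x)) (at x)"
      using Suc.prems(2) that by (simp add: frechet_derivative_works)
    from has_derivative_transform_within_open[OF this assms(1) that Suc.prems(1)]
    show ?thesis .
  qed
  have "Ck_on k (\<lambda>x. frechet_derivative g (at x) v) S" for v
  proof (rule Suc.IH)
    show "Ck_on k (\<lambda>x. frechet_derivative f (at x) v) S"
      using Suc.prems by simp
    show "frechet_derivative f (at x) v = frechet_derivative g (at x) v" if "x \<in> S" for x
      using frechet_derivative_at[OF der[OF that]] by simp
  qed
  with der show ?case by (auto simp: differentiable_def)
qed

text \<open>Replaces the chosen \<open>frechet_derivative\<close> by an explicit derivative
  \<open>F\<close>, so that the inductions below can work with closed formulas.\<close>

lemma Ck_on_SucI:
  assumes "open S" and "\<And>x. x \<in> S \<Longrightarrow> (f has_derivative F x) (at x)"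
    and "\<And>v. Ck_on k (\<lambda>x. F x v) S"
  shows "Ck_on (Suc k) f S"
proof -
  have "Ck_on k (\<lambda>x. frechet_derivative f (at x) v) S" for v
    by (rule Ck_on_cong[OF assms(1) _ assms(3)[of v]])
      (simp add: frechet_derivative_at[OF assms(2), symmetric])
  then show ?thesis using assms(2) by (auto simp: differentiable_def)
qed

lemma Ck_on_imp_continuous_on: "Ck_on k f S \<Longrightarrow> continuous_on S f"
  by (cases k)
    (auto intro!: continuous_at_imp_continuous_on differentiable_imp_continuous_within)

lemma smooth_onI_has_derivative:
  assumes "open S" and "\<And>x. x \<in> S \<Longrightarrow> (f has_derivative F x) (at x)"
    and "\<And>v. smooth_on (\<lambda>x. F x v) S"
  shows "smooth_on f S"
  unfolding smooth_on_def
proof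
  fix k
  have "Ck_on (Suc k) f S" for k
    using assms by (intro Ck_on_SucI) (auto simp: smooth_on_def)
  then show "Ck_on k f S"
    \<comment> \<open>Order 0 is not a successor; its continuity is read off from order 1.\<close>
    by (cases k) (auto intro: Ck_on_imp_continuous_on[of 1])
qed

lemma smooth_on_imp_continuous_on: "smooth_on f S \<Longrightarrow> continuous_on S f"
  unfolding smooth_on_def by (blast intro: Ck_on_imp_continuous_on)

lemma smooth_on_has_frechet_derivative:
  assumes "smooth_on f S" and "x \<in> S"
  shows "(f has_derivative frechet_derivative f (at x)) (at x)"
proof -
  have "Ck_on (Suc 0) f S" using assms(1) unfolding smooth_on_def by blast
  then show ?thesis using assms(2) by (simp add: frechet_derivative_works)
qed

lemma smooth_on_frechet_derivative:
  assumes "smooth_on f S"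
  shows "smooth_on (\<lambda>x. frechet_derivative f (at x) v) S"
  unfolding smooth_on_def
proof
  fix k
  have "Ck_on (Suc k) f S" using assms unfolding smooth_on_def by blast
  then show "Ck_on k (\<lambda>x. frechet_derivative f (at x) v) S" by simp
qed

lemma smooth_on_const:
  assumes "open S"
  shows "smooth_on (\<lambda>x. c) S"
proof -
  have "Ck_on k (\<lambda>x. c) S" for k
  proof (induction k arbitrary: c)
    case (Suc k)
    show ?case by (rule Ck_on_SucI[OF assms has_derivative_const Suc])
  qed simp
  then show ?thesis by (simp add: smooth_on_def)
qed

lemma smooth_on_bounded_linear:
  assumes "open S" and "bounded_linear f"
  shows "smooth_on f S"
  by (rule smooth_onI_has_derivative[OF assms(1) bounded_linear_imp_has_derivative[OF assms(2)]
        smooth_on_const[OF assms(1)]])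

section \<open>Closure under sums, bilinear products and composition\<close>

lemma Ck_on_add:
  assumes "open S" and "Ck_on k f S" and "Ck_on k g S"
  shows "Ck_on k (\<lambda>x. f x + g x) S"
  using assms(2,3)
proof (induction k arbitrary: f g)
  case 0
  then show ?case by (auto intro: continuous_on_add)
next
  case (Suc k)
  show ?case
  proof (rule Ck_on_SucI[OF assms(1)])
    show "((\<lambda>x. f x + g x) has_derivative
        (\<lambda>v. frechet_derivative f (at x) v + frechet_derivative g (at x) v)) (at x)"
      if "x \<in> S" for x
      using Suc.prems that by (intro has_derivative_add) (auto simp: frechet_derivative_works)
  qed (use Suc in auto)
qed

lemma smooth_on_add:
  "open S \<Longrightarrow> smooth_on f S \<Longrightarrow> smooth_on g S \<Longrightarrow> smooth_on (\<lambda>x. f x + g x) S"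
  by (simp add: smooth_on_def Ck_on_add)

text \<open>By the product rule the derivative is a sum of two values of \<open>B\<close> at smooth
  maps, so the induction on the order closes once \<open>f\<close> and \<open>g\<close> vary over
  all smooth maps. Real products and scalar multiples are both instances.\<close>

lemma smooth_on_bounded_bilinear:
  assumes "bounded_bilinear B" and "open S" and "smooth_on f S" and "smooth_on g S"
  shows "smooth_on (\<lambda>x. B (f x) (g x)) S"
proof -
  have "Ck_on k (\<lambda>x. B (f x) (g x)) S" for k
    using assms(3,4)
  proof (induction k arbitrary: f g)
    case 0
    then show ?case by (auto intro: bounded_bilinear.continuous_on[OF assms(1)]
          smooth_on_imp_continuous_on)
  next
    case (Suc k)
    show ?case
      by (rule Ck_on_SucI[OF assms(2) bounded_bilinear.FDERIV[OF assms(1)]])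
        (use Suc in \<open>auto intro!: Ck_on_add[OF assms(2)] smooth_on_frechet_derivative
            smooth_on_has_frechet_derivative\<close>)
  qed
  then show ?thesis by (simp add: smooth_on_def)
qed

text \<open>The chain rule turns a composite into a composite times a scalar function, so plain
  composites are not closed under differentiation. The induction therefore treats
  \<open>h x *\<^sub>R g (f x)\<close> with \<open>h\<close> smooth, and \<open>h = 1\<close> gives
  the claim.\<close>

lemma smooth_on_compose_real:
  fixes f :: "'a::real_normed_vector \<Rightarrow> real" and g :: "real \<Rightarrow> 'b::real_normed_vector"
  assumes "open S" and "smooth_on f S" and "smooth_on g T" and "f ` S \<subseteq> T"
  shows "smooth_on (\<lambda>x. g (f x)) S"
proof -
  have "Ck_on k (\<lambda>x. h x *\<^sub>R g (f x)) S" if "smooth_on h S" for h :: "'a \<Rightarrow> real" and k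
    using assms(3) that
  proof (induction k arbitrary: g h)
    case 0
    have "continuous_on S (\<lambda>x. g (f x))"
      using continuous_on_compose2[OF smooth_on_imp_continuous_on[OF 0(1)]
          smooth_on_imp_continuous_on[OF assms(2)] assms(4)] .
    then show ?case
      using 0(2) by (auto intro: continuous_on_scaleR smooth_on_imp_continuous_on)
  next
    case (Suc k)
    let ?g' = "\<lambda>y. frechet_derivative g (at y) 1"
    show ?case
    proof (rule Ck_on_SucI[OF assms(1)])
      fix x assume x: "x \<in> S"
      let ?Df = "frechet_derivative f (at x)"
      have f: "(f has_derivative ?Df) (at x)"
        by (rule smooth_on_has_frechet_derivative[OF assms(2) x])
      have g: "(g has_derivative frechet_derivative g (at (f x))) (at (f x))"
        using smooth_on_has_frechet_derivative[OF Suc.prems(1)] x assms(4) by blast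
      \<comment> \<open>As \<open>g\<close> has a real argument, its differential is determined by
        its value at 1.\<close>
      have "(\<lambda>v. frechet_derivative g (at (f x)) (?Df v)) = (\<lambda>v. ?Df v *\<^sub>R ?g' (f x))"
      proof
        fix v
        show "frechet_derivative g (at (f x)) (?Df v) = ?Df v *\<^sub>R ?g' (f x)"
          using linear_cmul[OF has_derivative_linear[OF g], of "?Df v" 1] by simp
      qed
      from has_derivative_eq_rhs[OF has_derivative_compose[OF f g] this]
      have "((\<lambda>x. g (f x)) has_derivative (\<lambda>v. ?Df v *\<^sub>R ?g' (f x))) (at x)" .
      from has_derivative_scaleR[OF smooth_on_has_frechet_derivative[OF Suc.prems(2) x] this]
      show "((\<lambda>x. h x *\<^sub>R g (f x)) has_derivative
          (\<lambda>v. (h x * ?Df v) *\<^sub>R ?g' (f x) + frechet_derivative h (at x) v *\<^sub>R g (f x))) (at x)"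
        by simp
    next
      fix v
      show "Ck_on k (\<lambda>x. (h x * frechet_derivative f (at x) v) *\<^sub>R ?g' (f x)
          + frechet_derivative h (at x) v *\<^sub>R g (f x)) S"
        using Suc.prems assms(1,2)
        by (intro Ck_on_add Suc.IH smooth_on_frechet_derivative
            smooth_on_bounded_bilinear[OF bounded_bilinear_mult]) auto
    qed
  qed
  from this[OF smooth_on_const[OF assms(1), of 1]] show ?thesis
    by (simp add: smooth_on_def)
qed

lemma smooth_on_mult:
  fixes f g :: "'a::real_normed_vector \<Rightarrow> real"
  shows "open S \<Longrightarrow> smooth_on f S \<Longrightarrow> smooth_on g S \<Longrightarrow> smooth_on (\<lambda>x. f x * g x) S"
  by (rule smooth_on_bounded_bilinear[OF bounded_bilinear_mult])

section \<open>Smoothness of elementary real functions\<close>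

lemma smooth_on_powr: "smooth_on (\<lambda>x::real. x powr a) {0<..}"
proof -
  \<comment> \<open>With \<open>a\<close> and \<open>c\<close> both free, this family is closed
    under differentiation.\<close>
  have "Ck_on k (\<lambda>x::real. c * x powr a) {0<..}" for k c
  proof (induction k arbitrary: a c)
    case 0
    show ?case by (auto intro!: continuous_intros)
  next
    case (Suc k)
    show ?case
    proof (rule Ck_on_SucI)
      show "((\<lambda>x. c * x powr a) has_derivative (\<lambda>v. (c * a * v) * x powr (a - 1))) (at x)"
        if "x \<in> {0<..}" for x :: real
        using that by (auto intro!: derivative_eq_intros simp: powr_diff)
    qed (use Suc in auto)
  qed
  from this[of _ 1] show ?thesis by (simp add: smooth_on_def)
qed

lemma smooth_on_inverse: "smooth_on (inverse :: real \<Rightarrow> real) {0<..}"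
  unfolding smooth_on_def
proof
  fix k
  show "Ck_on k (inverse :: real \<Rightarrow> real) {0<..}"
    by (rule Ck_on_cong[OF _ _ smooth_on_powr[unfolded smooth_on_def, rule_format, where a = "- 1"]])
      (auto simp: powr_minus)
qed

lemma smooth_on_sqrt: "smooth_on sqrt {0<..}"
  unfolding smooth_on_def
proof
  fix k
  show "Ck_on k sqrt {0<..}"
    by (rule Ck_on_cong[OF _ _ smooth_on_powr[unfolded smooth_on_def, rule_format, where a = "1/2"]])
      (auto simp: powr_half_sqrt)
qed

text \<open>A linear combination of sine and cosine is again one after differentiation.\<close>

lemma smooth_on_sin_cos: "smooth_on (\<lambda>x::real. a * sin x + b * cos x) UNIV"
proof -
  have "Ck_on k (\<lambda>x::real. a * sin x + b * cos x) UNIV" for k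
  proof (induction k arbitrary: a b)
    case 0
    show ?case by (auto intro!: continuous_intros)
  next
    case (Suc k)
    show ?case
    proof (rule Ck_on_SucI)
      show "((\<lambda>x. a * sin x + b * cos x) has_derivative
          (\<lambda>v. (- b * v) * sin x + (a * v) * cos x)) (at x)" for x :: real
        by (auto intro!: derivative_eq_intros)
    qed (simp, rule Suc)
  qed
  then show ?thesis by (simp add: smooth_on_def)
qed

lemma smooth_on_sin: "smooth_on (sin :: real \<Rightarrow> real) UNIV"
  using smooth_on_sin_cos[of 1 0] by simp

lemma smooth_on_cos: "smooth_on (cos :: real \<Rightarrow> real) UNIV"
  using smooth_on_sin_cos[of 0 1] by simp

section \<open>The pseudosphere in horocyclic coordinates\<close>

text \<open>Splitting along the axis vectors reduces the vector-valued map to scalar coefficients,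
  to which the sum and scaling rules apply.\<close>

lemma pseudosphere_param_eq:
  "pseudosphere_param \<eta> \<xi> = (cos \<xi> * inverse (cosh \<eta>)) *\<^sub>R axis 1 1
     + (sin \<xi> * inverse (cosh \<eta>)) *\<^sub>R axis 2 1 + (\<eta> - tanh \<eta>) *\<^sub>R axis 3 1"
  by (simp add: pseudosphere_param_def vec_eq_iff forall_3 axis_def divide_inverse)

text \<open>With \<open>y = cosh \<eta>\<close>, the height has \<eta>-derivative
  \<open>(tanh \<eta>)\<^sup>2\<close> and \<eta> has y-derivative \<open>1 / sinh \<eta>\<close>;
  the product is \<open>sinh \<eta> / y\<^sup>2\<close>. The shape \<open>y * y + - 1\<close>
  matches the closure rules for sums and products.\<close>

lemma has_real_derivative_arcosh_minus_tanh:
  assumes "1 < (y::real)"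
  shows "((\<lambda>y. arcosh y - tanh (arcosh y)) has_real_derivative
    sqrt (y * y + - 1) * (inverse y * inverse y)) (at y)"
proof -
  define s where "s = sqrt (y * y + - 1)"
  have y: "1 < y * y" using assms by (simp add: less_1_mult)
  have s: "s > 0" "s * s = y * y - 1" using y by (simp_all add: s_def)
  have t: "tanh (arcosh y) = s / y"
    using assms by (simp add: tanh_def sinh_arcosh_real cosh_arcosh_real s_def power2_eq_square)
  have "((\<lambda>y. arcosh y - tanh (arcosh y)) has_real_derivative
      1 / s - (1 - (tanh (arcosh y))\<^sup>2) * (1 / s)) (at y)"
    using assms
    by (auto intro!: derivative_eq_intros simp: s_def power2_eq_square)
  moreover have "1 / s - (1 - (tanh (arcosh y))\<^sup>2) * (1 / s) = s * (inverse y * inverse y)"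
    using s assms unfolding t by (simp add: field_simps power2_eq_square)
  ultimately show ?thesis
    unfolding s_def by metis
qed

text \<open>Smoothness is inherited from the derivative, which involves only \<open>sqrt\<close> and
  \<open>inverse\<close>; \<open>arcosh\<close> needs no separate treatment.\<close>

lemma smooth_on_arcosh_minus_tanh: "smooth_on (\<lambda>y::real. arcosh y - tanh (arcosh y)) {1<..}"
proof (rule smooth_onI_has_derivative)
  show "((\<lambda>y. arcosh y - tanh (arcosh y)) has_derivative
      (\<lambda>v. sqrt (y * y + - 1) * (inverse y * inverse y) * v)) (at y)" if "y \<in> {1<..}" for y :: real
    using has_real_derivative_arcosh_minus_tanh[of y] that by (simp add: has_field_derivative_def)
next
  let ?T = "{1<..} :: real set"
  have op: "open ?T" by simp
  note mult = smooth_on_mult[OF op] and const = smooth_on_const[OF op]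
  have id: "smooth_on (\<lambda>y. y) ?T"
    by (rule smooth_on_bounded_linear[OF op bounded_linear_ident])
  have inv: "smooth_on inverse ?T"
    by (rule smooth_on_subset[OF smooth_on_inverse]) auto
  have "smooth_on (\<lambda>y. sqrt (y * y + - 1)) ?T"
    by (rule smooth_on_compose_real[OF op smooth_on_add[OF op mult[OF id id] const] smooth_on_sqrt])
      (auto simp: less_1_mult)
  then show "smooth_on (\<lambda>y. sqrt (y * y + - 1) * (inverse y * inverse y) * v) ?T" for v
    by (intro mult const inv)
qed simp

lemma open_halfplane_Im_mult_gt: "open {z. 1 < l * Im z}"
  by (intro open_Collect_less continuous_intros)

text \<open>On this half-plane \<open>cosh (arcosh (l * Im z)) = l * Im z\<close>, so the horizontal
  coordinates involve only \<open>sin\<close>, \<open>cos\<close> and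
  \<open>inverse\<close>.\<close>

lemma smooth_on_pseudosphere_param:
  "smooth_on (\<lambda>z. pseudosphere_param (arcosh (l * Im z)) (l * Re z)) {z. 1 < l * Im z}"
    (is "smooth_on _ ?S")
proof -
  note op = open_halfplane_Im_mult_gt[of l]
  note mult = smooth_on_mult[OF op] and add = smooth_on_add[OF op]
    and const = smooth_on_const[OF op] and comp = smooth_on_compose_real[OF op]
    and scale = smooth_on_bounded_bilinear[OF bounded_bilinear_scaleR op]
  have re: "smooth_on (\<lambda>z. l * Re z) ?S" and im: "smooth_on (\<lambda>z. l * Im z) ?S"
    by (intro mult const smooth_on_bounded_linear[OF op] bounded_linear_Re bounded_linear_Im)+
  have inv: "smooth_on (\<lambda>z. inverse (l * Im z)) ?S"
    by (rule comp[OF im smooth_on_inverse]) auto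
  have h: "smooth_on (\<lambda>z. arcosh (l * Im z) - tanh (arcosh (l * Im z))) ?S"
    by (rule comp[OF im smooth_on_arcosh_minus_tanh]) auto
  have sm: "smooth_on (\<lambda>z. (cos (l * Re z) * inverse (l * Im z)) *\<^sub>R axis 1 1
      + (sin (l * Re z) * inverse (l * Im z)) *\<^sub>R axis 2 1
      + (arcosh (l * Im z) - tanh (arcosh (l * Im z))) *\<^sub>R axis 3 1 :: real^3) ?S"
    by (intro add scale const mult inv h comp[OF re smooth_on_sin] comp[OF re smooth_on_cos]) auto
  show ?thesis
    unfolding smooth_on_def
  proof
    fix k
    show "Ck_on k (\<lambda>z. pseudosphere_param (arcosh (l * Im z)) (l * Re z)) ?S"
      by (rule Ck_on_cong[OF op _ sm[unfolded smooth_on_def, rule_format]])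
        (simp add: pseudosphere_param_eq cosh_arcosh_real)
  qed
qed

lemma isometric_immersion_on_pseudosphere_param:
  assumes "l > 0"
  shows "isometric_immersion_on (\<lambda>z. pseudosphere_param (arcosh (l * Im z)) (l * Re z))
    {z. 1 < l * Im z}"
    (is "isometric_immersion_on ?X ?S")
  unfolding isometric_immersion_on_def
proof (intro ballI)
  fix z assume z: "z \<in> ?S"
  define x y r where "x = l * Re z" and "y = l * Im z" and "r = sqrt (y * y + - 1)"
  have y: "1 < y" using z by (simp add: y_def)
  have z0: "Im z > 0" using y assms zero_less_mult_pos[of l "Im z"] by (simp add: y_def)
  have r: "r * r = y * y - 1" using less_1_mult[OF y y] by (simp add: r_def)
  \<comment> \<open>\<open>?a\<close>, \<open>?b\<close> and \<open>?c\<close> are the three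
    coordinates of the differential at \<open>z\<close>.\<close>
  let ?a = "\<lambda>v. l * (- sin x * Re v / y - cos x * Im v / (y * y))"
  let ?b = "\<lambda>v. l * (cos x * Re v / y - sin x * Im v / (y * y))"
  let ?c = "\<lambda>v. r * (inverse y * inverse y) * (l * Im v)"
  let ?D = "\<lambda>v. ?a v *\<^sub>R axis 1 1 + ?b v *\<^sub>R axis 2 1 + ?c v *\<^sub>R axis 3 1 :: real^3"
  have im: "((\<lambda>z. l * Im z) has_derivative (\<lambda>v. l * Im v)) (at z)"
    by (intro derivative_intros)
  have c: "((\<lambda>z. arcosh (l * Im z) - tanh (arcosh (l * Im z))) has_derivative ?c) (at z)"
    using has_derivative_compose[OF im
        has_real_derivative_arcosh_minus_tanh[unfolded has_field_derivative_def]] y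
    by (simp add: y_def r_def)
  have a: "((\<lambda>z. cos (l * Re z) * inverse (l * Im z)) has_derivative ?a) (at z)"
    using z0 assms by (auto intro!: derivative_eq_intros simp: x_def y_def fun_eq_iff field_simps)
  have b: "((\<lambda>z. sin (l * Re z) * inverse (l * Im z)) has_derivative ?b) (at z)"
    using z0 assms by (auto intro!: derivative_eq_intros simp: x_def y_def fun_eq_iff field_simps)
  have D: "(?X has_derivative ?D) (at z)"
  proof (rule has_derivative_transform_within_open[OF _ open_halfplane_Im_mult_gt z])
    show "((\<lambda>z. (cos (l * Re z) * inverse (l * Im z)) *\<^sub>R axis 1 1
        + (sin (l * Re z) * inverse (l * Im z)) *\<^sub>R axis 2 1
        + (arcosh (l * Im z) - tanh (arcosh (l * Im z))) *\<^sub>R axis 3 1) has_derivative ?D) (at z)"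
      by (intro has_derivative_add has_derivative_scaleR_left a b c)
  qed (simp add: pseudosphere_param_eq cosh_arcosh_real)
  have "?D v \<bullet> ?D w = hyp_metric z v w" for v w
  proof -
    have "?D v \<bullet> ?D w = ?a v * ?a w + ?b v * ?b w + ?c v * ?c w"
      by (simp add: inner_vec_def sum_3 axis_def)
    \<comment> \<open>The mixed terms in \<open>Re\<close> and \<open>Im\<close> cancel. The sum of
      squares of \<open>sin x\<close> and \<open>cos x\<close> is kept unevaluated, which leaves a
      polynomial identity.\<close>
    also have "?a v * ?a w + ?b v * ?b w =
        l\<^sup>2 * ((sin x)\<^sup>2 + (cos x)\<^sup>2) * (Re v * Re w / y^2 + Im v * Im w / y^4)"
      by (simp add: divide_inverse algebra_simps power2_eq_square power4_eq_xxxx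
          del: sin_cos_squared_add sin_cos_squared_add2 sin_cos_squared_add3)
    also have "?c v * ?c w = l\<^sup>2 * (r * r) * (Im v * Im w / y^4)"
      by (simp add: field_simps power2_eq_square power4_eq_xxxx)
    \<comment> \<open>The \<open>Im v * Im w / y^4\<close> terms have coefficients 1 and
      \<open>y * y - 1\<close> up to \<open>l\<^sup>2\<close>; together they give
      \<open>Im v * Im w / y^2\<close>, matching the \<open>Re\<close> term.\<close>
    also have "l\<^sup>2 * ((sin x)\<^sup>2 + (cos x)\<^sup>2) * (Re v * Re w / y^2 + Im v * Im w / y^4)
        + l\<^sup>2 * (r * r) * (Im v * Im w / y^4) = l\<^sup>2 * (v \<bullet> w) / y\<^sup>2"
      unfolding r using y by (simp add: inner_complex_def field_simps power2_eq_square power4_eq_xxxx)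
    also have "\<dots> = hyp_metric z v w"
      using assms by (simp add: hyp_metric_def y_def power_mult_distrib)
    finally show ?thesis .
  qed
  then show "?X differentiable at z \<and>
      (\<forall>v w. frechet_derivative ?X (at z) v \<bullet> frechet_derivative ?X (at z) w = hyp_metric z v w)"
    using D unfolding frechet_derivative_at[OF D, symmetric] differentiable_def by blast
qed

section \<open>Heights in a hyperbolic disk\<close>

text \<open>Makes the set of lengths nonempty, so that a lower bound for all lengths also bounds
  their infimum \<open>hyp_dist\<close>.\<close>

lemma hyp_curve_exists:
  assumes "p \<in> hyp_plane" and "q \<in> hyp_plane"
  shows "hyp_curve (linepath p q) p q"
proof -
  have "convex hyp_plane"
    unfolding hyp_plane_def by (rule convex_halfspace_Im_gt)
  then have "closed_segment p q \<subseteq> hyp_plane"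
    using assms by (simp add: closed_segment_subset)
  moreover have "linepath p q C1_differentiable_on {0..1}"
    unfolding C1_differentiable_on_def
    by (intro exI[of _ "\<lambda>_. q - p"])
      (auto intro: has_vector_derivative_linepath_within)
  ultimately show ?thesis by (simp add: hyp_curve_def)
qed

text \<open>The length integrand \<open>norm (D t) / Im (\<gamma> t)\<close> dominates the
  derivative of \<open>- ln (Im (\<gamma> t))\<close>, whose integral is the left-hand side.\<close>

lemma hyp_length_ge_ln_Im:
  assumes "hyp_curve \<gamma> p q"
  shows "ln (Im p) - ln (Im q) \<le> hyp_length \<gamma>"
proof -
  obtain D where D: "\<And>t. t \<in> {0..1} \<Longrightarrow> (\<gamma> has_vector_derivative D t) (at t)"
      and contD: "continuous_on {0..1} D"
    using assms unfolding hyp_curve_def C1_differentiable_on_def by blast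
  have pos: "Im (\<gamma> t) > 0" if "t \<in> {0..1}" for t
    using assms that unfolding hyp_curve_def path_image_def hyp_plane_def by blast
  have cont\<gamma>: "continuous_on {0..1} \<gamma>"
    using has_vector_derivative_continuous[OF D] by (auto intro: continuous_at_imp_continuous_on)
  have der: "((\<lambda>t. - ln (Im (\<gamma> t))) has_vector_derivative - (Im (D t) / Im (\<gamma> t)))
      (at t within {0..1})" if "t \<in> {0..1}" for t
  proof -
    have "((\<lambda>t. Im (\<gamma> t)) has_real_derivative Im (D t)) (at t within {0..1})"
      using bounded_linear.has_vector_derivative[OF bounded_linear_Im
          has_vector_derivative_at_within[OF D[OF that]]]
      by (simp add: has_real_derivative_iff_has_vector_derivative)
    then have "((\<lambda>t. - ln (Im (\<gamma> t))) has_real_derivative - (Im (D t) / Im (\<gamma> t)))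
        (at t within {0..1})"
      using DERIV_minus[OF DERIV_chain2[where f = ln and g = "\<lambda>t. Im (\<gamma> t)",
            OF DERIV_ln_divide[OF pos[OF that]]]] by fastforce
    then show ?thesis by (simp add: has_real_derivative_iff_has_vector_derivative)
  qed
  have ln: "((\<lambda>t. - (Im (D t) / Im (\<gamma> t))) has_integral ln (Im p) - ln (Im q)) {0..1}"
    using fundamental_theorem_of_calculus[OF _ der] assms
    by (simp add: hyp_curve_def pathstart_def pathfinish_def)
  \<comment> \<open>Integrability matters: \<open>integral\<close> would otherwise default to 0 and
    the bound could fail. It comes from the continuity of \<open>D\<close>.\<close>
  have int: "(\<lambda>t. norm (D t) / Im (\<gamma> t)) integrable_on {0..1}"
    using pos by (intro integrable_continuous_real continuous_intros contD cont\<gamma>) force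
  have len: "((\<lambda>t. norm (D t) / Im (\<gamma> t)) has_integral hyp_length \<gamma>) {0..1}"
  proof -
    have "hyp_length \<gamma> = integral {0..1} (\<lambda>t. norm (D t) / Im (\<gamma> t))"
      unfolding hyp_length_def
    proof (rule integral_cong)
      fix t :: real assume t: "t \<in> {0..1}"
      show "sqrt (hyp_metric (\<gamma> t) (vector_derivative \<gamma> (at t)) (vector_derivative \<gamma> (at t)))
          = norm (D t) / Im (\<gamma> t)"
        using pos[OF t] by (simp add: vector_derivative_at[OF D[OF t]] hyp_metric_def
            real_sqrt_divide norm_eq_sqrt_inner)
    qed
    then show ?thesis using integrable_integral[OF int] by simp
  qed
  show ?thesis
  proof (rule has_integral_le[OF ln len])
    fix t :: real assume t: "t \<in> {0..1}"
    have "- Im (D t) \<le> norm (D t)"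
      using abs_Im_le_cmod[of "D t"] by linarith
    then show "- (Im (D t) / Im (\<gamma> t)) \<le> norm (D t) / Im (\<gamma> t)"
      using pos[OF t] divide_right_mono by fastforce
  qed
qed

lemma Im_gt_of_mem_hyp_disk:
  assumes "p \<in> hyp_plane" and "q \<in> hyp_disk p R"
  shows "Im p < exp R * Im q"
proof -
  have q: "q \<in> hyp_plane" "hyp_dist p q < R"
    using assms(2) by (auto simp: hyp_disk_def)
  have "ln (Im p) - ln (Im q) \<le> hyp_dist p q"
    unfolding hyp_dist_def
    by (rule cInf_greatest)
      (use hyp_curve_exists[OF assms(1) q(1)] hyp_length_ge_ln_Im in auto)
  with q(2) have "ln (Im p) < R + ln (Im q)" by simp
  then have "exp (ln (Im p)) < exp (R + ln (Im q))" by simp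
  then show ?thesis
    using assms(1) q(1) by (simp add: hyp_plane_def exp_add)
qed

theorem proposition4p1:
  fixes R :: real and p :: complex and D :: "complex set"
  assumes "R > 0" and "p \<in> hyp_plane" and "D = hyp_disk p R"
  shows "\<exists>(x :: complex \<Rightarrow> real^3) U.
    smooth_on x D \<and> isometric_immersion_on x D \<and> U = x ` D \<and> U \<subseteq> upper_pseudosphere"
proof -
  \<comment> \<open>Chosen so that \<open>Im p < exp R * Im q\<close> becomes
    \<open>1 < l * Im q\<close>.\<close>
  define l where "l = exp R / Im p"
  have p: "Im p > 0" using assms(2) by (simp add: hyp_plane_def)
  have l: "l > 0" using p by (simp add: l_def)
  have D: "D \<subseteq> {z. 1 < l * Im z}"
    using Im_gt_of_mem_hyp_disk[OF assms(2)] p by (auto simp: assms(3) l_def field_simps)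
  let ?x = "\<lambda>z. pseudosphere_param (arcosh (l * Im z)) (l * Re z)"
  have "smooth_on ?x D"
    by (rule smooth_on_subset[OF smooth_on_pseudosphere_param D])
  moreover have "isometric_immersion_on ?x D"
    using isometric_immersion_on_pseudosphere_param[OF l] D
    unfolding isometric_immersion_on_def by blast
  \<comment> \<open>Since \<open>l * Im z > 1\<close>, the parameter
    \<open>arcosh (l * Im z)\<close> is positive, which selects the upper half.\<close>
  moreover have "?x ` D \<subseteq> upper_pseudosphere"
    using D arcosh_real_gt_1_iff unfolding upper_pseudosphere_def by fastforce
  ultimately show ?thesis by blast
qed

end
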